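(* Let $\ell:\mathbb{R}^{n+1}\times\mathbb{R}^{m+1}\times\mathbb{R}^{s+1}\to\mathbb{R}$ be a generic trilinear form. There exists a bijection between classes of extreme points of $\ell$ and solutions $([x],[y],[z])$ of the following system of trilinear equations in $\mathbb{P}^n\times\mathbb{P}^m\times\mathbb{P}^s$: $$\left\{\begin{array}{rcl} \ell(x_je_i-x_ie_j,y,z)&=&0,\quad 0\leq i<j\leq n,\\ \ell(x,y_je_i-y_ie_j,z)&=&0,\quad 0\leq i<j\leq m,\\ \ell(x,y,z_je_i-z_ie_j)&=&0,\quad 0\leq i<j\leq s. \end{array}\right.$$ More generally, for a generic $r$-linear form $\ell:\mathbb{R}^{n_1+1}\times\cdots\times\mathbb{R}^{n_r+1}\to\mathbb{R}$ there is a bijection between classes of extreme points of $\ell$ and solutions $([x^1],\dots,[x^r])\in\mathbb{P}^{n_1}\times\cdots\times\mathbb{P}^{n_r}$ of the system of multilinear equations $$\ell(x^1,\dots,x^{k-1},\,x^k_je_i-x^k_ie_j,\,x^{k+1},\dots,x^r)=0,\qquad 1\le k\le r,\ 0\le i<j\le n_k.$$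
   Context: $\mathbb{P}^n$ denotes the real projective space of lines through the origin in $\mathbb{R}^{n+1}$, and $\mathbb{S}^n\subseteq\mathbb{R}^{n+1}$ is the Euclidean unit sphere. Coordinates are indexed from $0$, and $e_k$ denotes the canonical basis vector with $(e_k)_k=1$ and $(e_k)_l=0$ for $l\ne k$ (in the Euclidean space of the corresponding argument). "Generic" means that the coefficients of $\ell$ lie in some nonempty Zariski open subset of the space of all coefficients. A point $(x^1,\dots,x^r)\in\mathbb{S}^{n_1}\times\cdots\times\mathbb{S}^{n_r}$ is an extreme point of $\ell$ if there exist $\alpha_1,\dots,\alpha_r\in\mathbb{R}$ such that $\frac{\partial\ell}{\partial x^k}(x^1,\dots,x^r)=2\alpha_kx^k$ for all $1\le k\le r$, where $\frac{\partial\ell}{\partial x^k}=\left(\frac{\partial\ell}{\partial x^k_0},\dots,\frac{\partial\ell}{\partial x^k_{n_k}}\right)$. If $(x^1,\dots,x^r)$ is an extreme point, then so are all the points $(\pm x^1,\dots,\pm x^r)$ (independent signs); these are said to belong to the same class. The trilinear case is $r=3$ with $(x^1,x^2,x^3)=(x,y,z)$. *)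

theory Defs
  imports "HOL-Analysis.Derivative" "HOL-Library.FuncSet" "Jordan_Normal_Form.Matrix"
begin

text \<open>Polynomials are represented by the functions they induce, which over \<open>\<real>\<close> loses nothing.
  The affine space \<open>\<real>\<^sup>I\<close> consists of the extensional functions on \<open>I\<close>.\<close>

inductive_set poly_funs :: "'i set \<Rightarrow> (('i \<Rightarrow> real) \<Rightarrow> real) set" for I :: "'i set" where
  const: "(\<lambda>a. c) \<in> poly_funs I"
| var: "i \<in> I \<Longrightarrow> (\<lambda>a. a i) \<in> poly_funs I"
| add: "p \<in> poly_funs I \<Longrightarrow> q \<in> poly_funs I \<Longrightarrow> (\<lambda>a. p a + q a) \<in> poly_funs I"
| mult: "p \<in> poly_funs I \<Longrightarrow> q \<in> poly_funs I \<Longrightarrow> (\<lambda>a. p a * q a) \<in> poly_funs I"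

definition zero_locus :: "'i set \<Rightarrow> (('i \<Rightarrow> real) \<Rightarrow> real) set \<Rightarrow> ('i \<Rightarrow> real) set" where
  "zero_locus I S = {a \<in> I \<rightarrow>\<^sub>E UNIV. \<forall>p\<in>S. p a = 0}"

definition zariski_open :: "'i set \<Rightarrow> ('i \<Rightarrow> real) set \<Rightarrow> bool" where
  "zariski_open I U \<longleftrightarrow> (\<exists>S \<subseteq> poly_funs I. U = (I \<rightarrow>\<^sub>E UNIV) - zero_locus I S)"

definition unit_sphere :: "nat \<Rightarrow> real vec set" where
  "unit_sphere n = {v \<in> carrier_vec (n + 1). sqrt (scalar_prod v v) = 1}"

definition nonzero_vecs :: "nat \<Rightarrow> real vec set" where
  "nonzero_vecs n = carrier_vec (n + 1) - {0\<^sub>v (n + 1)}"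

text \<open>For nonzero \<open>v\<close> this is the point \<open>[v]\<close> of projective space, a line through the origin.\<close>

definition proj_point :: "real vec \<Rightarrow> real vec set" where
  "proj_point v = {c \<cdot>\<^sub>v v | c. True}"

definition gradient :: "nat \<Rightarrow> (real vec \<Rightarrow> real) \<Rightarrow> real vec \<Rightarrow> real vec" where
  "gradient d f v = vec d (\<lambda>i. deriv (\<lambda>t. f (v + t \<cdot>\<^sub>v unit_vec d i)) 0)"

definition minor_vec :: "nat \<Rightarrow> real vec \<Rightarrow> nat \<Rightarrow> nat \<Rightarrow> real vec" where
  "minor_vec n v i j =
     vec_index v j \<cdot>\<^sub>v unit_vec (n + 1) i - vec_index v i \<cdot>\<^sub>v unit_vec (n + 1) j"

definition linear_form_on :: "nat \<Rightarrow> (real vec \<Rightarrow> real) \<Rightarrow> bool" where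
  "linear_form_on d f \<longleftrightarrow>
     (\<forall>u \<in> carrier_vec d. \<forall>v \<in> carrier_vec d. f (u + v) = f u + f v) \<and>
     (\<forall>c. \<forall>v \<in> carrier_vec d. f (c \<cdot>\<^sub>v v) = c * f v)"

type_synonym tri_form = "real vec \<Rightarrow> real vec \<Rightarrow> real vec \<Rightarrow> real"

definition trilinear_form :: "nat \<Rightarrow> nat \<Rightarrow> nat \<Rightarrow> tri_form \<Rightarrow> bool" where
  "trilinear_form n m s l \<longleftrightarrow>
     (\<forall>x \<in> carrier_vec (n + 1). \<forall>y \<in> carrier_vec (m + 1). \<forall>z \<in> carrier_vec (s + 1).
        linear_form_on (n + 1) (\<lambda>u. l u y z) \<and>
        linear_form_on (m + 1) (\<lambda>u. l x u z) \<and>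
        linear_form_on (s + 1) (\<lambda>u. l x y u))"

definition tri_index :: "nat \<Rightarrow> nat \<Rightarrow> nat \<Rightarrow> (nat \<times> nat \<times> nat) set" where
  "tri_index n m s = {..n} \<times> {..m} \<times> {..s}"

definition tri_coeffs :: "nat \<Rightarrow> nat \<Rightarrow> nat \<Rightarrow> tri_form \<Rightarrow> nat \<times> nat \<times> nat \<Rightarrow> real" where
  "tri_coeffs n m s l = (\<lambda>(i, j, k) \<in> tri_index n m s.
     l (unit_vec (n + 1) i) (unit_vec (m + 1) j) (unit_vec (s + 1) k))"

definition tri_extreme :: "nat \<Rightarrow> nat \<Rightarrow> nat \<Rightarrow> tri_form \<Rightarrow> (real vec \<times> real vec \<times> real vec) set" where
  "tri_extreme n m s l = {(x, y, z) \<in> unit_sphere n \<times> unit_sphere m \<times> unit_sphere s.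
     \<exists>\<alpha> \<beta> \<gamma>. gradient (n + 1) (\<lambda>u. l u y z) x = (2 * \<alpha>) \<cdot>\<^sub>v x \<and>
             gradient (m + 1) (\<lambda>u. l x u z) y = (2 * \<beta>) \<cdot>\<^sub>v y \<and>
             gradient (s + 1) (\<lambda>u. l x y u) z = (2 * \<gamma>) \<cdot>\<^sub>v z}"

definition tri_sign_rel ::
    "nat \<Rightarrow> nat \<Rightarrow> nat \<Rightarrow> tri_form \<Rightarrow> (real vec \<times> real vec \<times> real vec) rel" where
  "tri_sign_rel n m s l = {((x, y, z), (x', y', z')).
     (x, y, z) \<in> tri_extreme n m s l \<and> (x', y', z') \<in> tri_extreme n m s l \<and>
     (x' = x \<or> x' = - x) \<and> (y' = y \<or> y' = - y) \<and> (z' = z \<or> z' = - z)}"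

definition tri_extreme_classes ::
    "nat \<Rightarrow> nat \<Rightarrow> nat \<Rightarrow> tri_form \<Rightarrow> (real vec \<times> real vec \<times> real vec) set set" where
  "tri_extreme_classes n m s l = tri_extreme n m s l // tri_sign_rel n m s l"

text \<open>The equations are homogeneous in each argument, so for a multilinear form it does not matter
  which representatives of the projective points are used.\<close>

definition tri_solutions ::
    "nat \<Rightarrow> nat \<Rightarrow> nat \<Rightarrow> tri_form \<Rightarrow> (real vec set \<times> real vec set \<times> real vec set) set" where
  "tri_solutions n m s l = {(proj_point x, proj_point y, proj_point z) | x y z.
     x \<in> nonzero_vecs n \<and> y \<in> nonzero_vecs m \<and> z \<in> nonzero_vecs s \<and>
     (\<forall>i j. i < j \<and> j \<le> n \<longrightarrow> l (minor_vec n x i j) y z = 0) \<and>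
     (\<forall>i j. i < j \<and> j \<le> m \<longrightarrow> l x (minor_vec m y i j) z = 0) \<and>
     (\<forall>i j. i < j \<and> j \<le> s \<longrightarrow> l x y (minor_vec s z i j) = 0)}"

text \<open>An element of \<open>\<real>\<^bsup>n\<^sub>1+1\<^esup> \<times> \<dots> \<times> \<real>\<^bsup>n\<^sub>r+1\<^esup>\<close> is an extensional function on \<open>{1..r}\<close>;
  replacing its \<open>k\<close>-th component by \<open>u\<close> is the update \<open>x(k := u)\<close>. Values of forms outside this
  product are irrelevant.\<close>

type_synonym form = "(nat \<Rightarrow> real vec) \<Rightarrow> real"

definition multilinear_form :: "nat \<Rightarrow> (nat \<Rightarrow> nat) \<Rightarrow> form \<Rightarrow> bool" where
  "multilinear_form r n l \<longleftrightarrow>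
     (\<forall>x \<in> (\<Pi>\<^sub>E k\<in>{1..r}. carrier_vec (n k + 1)). \<forall>k \<in> {1..r}.
        linear_form_on (n k + 1) (\<lambda>u. l (x(k := u))))"

definition multi_index :: "nat \<Rightarrow> (nat \<Rightarrow> nat) \<Rightarrow> (nat \<Rightarrow> nat) set" where
  "multi_index r n = (\<Pi>\<^sub>E k\<in>{1..r}. {..n k})"

definition form_coeffs :: "nat \<Rightarrow> (nat \<Rightarrow> nat) \<Rightarrow> form \<Rightarrow> (nat \<Rightarrow> nat) \<Rightarrow> real" where
  "form_coeffs r n l =
     (\<lambda>j \<in> multi_index r n. l (\<lambda>k\<in>{1..r}. unit_vec (n k + 1) (j k)))"

definition extreme_points :: "nat \<Rightarrow> (nat \<Rightarrow> nat) \<Rightarrow> form \<Rightarrow> (nat \<Rightarrow> real vec) set" where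
  "extreme_points r n l = {x \<in> (\<Pi>\<^sub>E k\<in>{1..r}. unit_sphere (n k)).
     \<exists>\<alpha> :: nat \<Rightarrow> real. \<forall>k \<in> {1..r}.
       gradient (n k + 1) (\<lambda>u. l (x(k := u))) (x k) = (2 * \<alpha> k) \<cdot>\<^sub>v x k}"

definition sign_rel :: "nat \<Rightarrow> (nat \<Rightarrow> nat) \<Rightarrow> form \<Rightarrow> (nat \<Rightarrow> real vec) rel" where
  "sign_rel r n l = {(x, x'). x \<in> extreme_points r n l \<and> x' \<in> extreme_points r n l \<and>
     (\<forall>k \<in> {1..r}. x' k = x k \<or> x' k = - x k)}"

definition extreme_classes :: "nat \<Rightarrow> (nat \<Rightarrow> nat) \<Rightarrow> form \<Rightarrow> (nat \<Rightarrow> real vec) set set" where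
  "extreme_classes r n l = extreme_points r n l // sign_rel r n l"

definition solutions :: "nat \<Rightarrow> (nat \<Rightarrow> nat) \<Rightarrow> form \<Rightarrow> (nat \<Rightarrow> real vec set) set" where
  "solutions r n l = {(\<lambda>k\<in>{1..r}. proj_point (x k)) | x.
     x \<in> (\<Pi>\<^sub>E k\<in>{1..r}. nonzero_vecs (n k)) \<and>
     (\<forall>k \<in> {1..r}. \<forall>i j. i < j \<and> j \<le> n k \<longrightarrow> l (x(k := minor_vec (n k) (x k) i j)) = 0)}"

end

theory Submission
  imports Defs
begin

text \<open>For a linear form \<open>f\<close> the gradient is the constant vector \<open>(f e\<^sub>0, \<dots>, f e\<^sub>n)\<close>, and
  \<open>f (x\<^sub>j e\<^sub>i - x\<^sub>i e\<^sub>j) = x\<^sub>j f e\<^sub>i - x\<^sub>i f e\<^sub>j\<close> is a \<open>2 \<times> 2\<close> minor of the matrix with rows gradient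
  and \<open>x\<close>. Hence these minors vanish iff the gradient is a multiple of \<open>x \<noteq> 0\<close>, so on the product
  of spheres the system describes exactly the extreme points. A line meets the sphere in a pair
  \<open>\<plusminus>x\<close>, so sending an extreme point to the tuple of lines it spans induces the bijection.\<close>

section \<open>Quotients by the kernel of a map, and a Zariski open set\<close>

text \<open>The classes of \<open>R\<close> are the fibres of \<open>f\<close> over its image
  \<open>B\<close>. Sending a point of \<open>B\<close> to its fibre requires no choice of
  representatives, so this map is shown bijective and then inverted.\<close>

lemma bij_betw_quotient_kernel:
  assumes "R = {(a, b). a \<in> A \<and> b \<in> A \<and> f a = f b}" and "f ` A = B"
  shows "\<exists>\<Phi>. bij_betw \<Phi> (A // R) B"
proof -
  have cls: "R `` {a} = {b \<in> A. f b = f a}" if "a \<in> A" for a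
    using that assms(1) by auto
  have "bij_betw (\<lambda>b. {a \<in> A. f a = b}) B (A // R)"
    unfolding bij_betw_def
  proof (intro conjI inj_onI)
    fix b c assume "b \<in> B" "c \<in> B" and eq: "{a \<in> A. f a = b} = {a \<in> A. f a = c}"
    then show "b = c" using assms(2) by blast
  next
    have "A // R = (\<lambda>a. {b \<in> A. f b = f a}) ` A"
      unfolding quotient_def using cls by auto
    then show "(\<lambda>b. {a \<in> A. f a = b}) ` B = A // R"
      using assms(2) by auto
  qed
  then show ?thesis using bij_betw_inv_into by blast
qed

lemma zariski_open_whole_space: "zariski_open I (I \<rightarrow>\<^sub>E UNIV)"
  unfolding zariski_open_def
  \<comment> \<open>The constant polynomial 1 has empty zero locus.\<close>
  by (rule exI[of _ "{\<lambda>a. 1}"]) (auto simp: zero_locus_def intro: poly_funs.const)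

section \<open>Linear forms: gradients and minors\<close>

lemma minor_vec_carrier: "minor_vec n v i j \<in> carrier_vec (n + 1)"
  by (simp add: minor_vec_def)

lemma minor_vec_smult:
  assumes "v \<in> carrier_vec (n + 1)" "i \<le> n" "j \<le> n"
  shows "minor_vec n (c \<cdot>\<^sub>v v) i j = c \<cdot>\<^sub>v minor_vec n v i j"
  using assms by (intro eq_vecI) (auto simp: minor_vec_def algebra_simps)

lemma linear_form_minor_vec:
  assumes "linear_form_on (n + 1) f"
  shows "f (minor_vec n x i j) =
    vec_index x j * f (unit_vec (n + 1) i) - vec_index x i * f (unit_vec (n + 1) j)"
proof -
  \<comment> \<open>The difference becomes a sum because \<open>linear_form_on\<close> speaks of
    sums and scalar multiples only.\<close>
  have "minor_vec n x i j =
      vec_index x j \<cdot>\<^sub>v unit_vec (n + 1) i + (- vec_index x i) \<cdot>\<^sub>v unit_vec (n + 1) j"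
    by (intro eq_vecI) (auto simp: minor_vec_def)
  then show ?thesis
    using assms by (simp add: linear_form_on_def)
qed

lemma nonzero_vecs_index:
  assumes "v \<in> nonzero_vecs n"
  obtains k where "k \<le> n" "vec_index v k \<noteq> 0"
  using assms by (auto simp: nonzero_vecs_def vec_eq_iff less_Suc_eq_le)

lemma gradient_linear_form:
  assumes "linear_form_on d f" and "x \<in> carrier_vec d"
  shows "gradient d f x = vec d (\<lambda>i. f (unit_vec d i))"
proof -
  have "deriv (\<lambda>t. f (x + t \<cdot>\<^sub>v unit_vec d i)) 0 = f (unit_vec d i)" for i
  proof -
    \<comment> \<open>Along each coordinate line through \<open>x\<close> the form is affine in
      \<open>t\<close>, with slope its value on the basis vector.\<close>
    have "(\<lambda>t. f (x + t \<cdot>\<^sub>v unit_vec d i)) = (\<lambda>t. f x + t * f (unit_vec d i))"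
      using assms by (simp add: linear_form_on_def)
    moreover have "((\<lambda>t. f x + t * f (unit_vec d i)) has_real_derivative f (unit_vec d i)) (at 0)"
      by (auto intro!: derivative_eq_intros)
    ultimately show ?thesis by (simp add: DERIV_imp_deriv)
  qed
  then show ?thesis by (simp add: gradient_def)
qed

lemma gradient_parallel_iff_minors:
  assumes lin: "linear_form_on (n + 1) f" and x: "x \<in> nonzero_vecs n"
  shows "(\<exists>\<alpha>. gradient (n + 1) f x = (2 * \<alpha>) \<cdot>\<^sub>v x) \<longleftrightarrow>
    (\<forall>i j. i < j \<and> j \<le> n \<longrightarrow> f (minor_vec n x i j) = 0)"
proof -
  define g where "g i = f (unit_vec (n + 1) i)" for i
  have carr: "x \<in> carrier_vec (n + 1)"
    using x by (simp add: nonzero_vecs_def)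
  obtain k where k: "k \<le> n" "vec_index x k \<noteq> 0"
    using x by (rule nonzero_vecs_index)
  have minor: "f (minor_vec n x i j) = vec_index x j * g i - vec_index x i * g j" for i j
    using linear_form_minor_vec[OF lin] by (simp add: g_def)
  have grad: "gradient (n + 1) f x = (2 * \<alpha>) \<cdot>\<^sub>v x \<longleftrightarrow> (\<forall>i\<le>n. g i = 2 * \<alpha> * vec_index x i)" for \<alpha>
    using gradient_linear_form[OF lin carr] carr
    by (auto simp: vec_eq_iff g_def less_Suc_eq_le)
  show ?thesis
    unfolding grad minor
  proof (intro iffI)
    assume "\<exists>\<alpha>. \<forall>i\<le>n. g i = 2 * \<alpha> * vec_index x i"
    then show "\<forall>i j. i < j \<and> j \<le> n \<longrightarrow> vec_index x j * g i - vec_index x i * g j = 0"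
      by auto
  next
    assume 0: "\<forall>i j. i < j \<and> j \<le> n \<longrightarrow> vec_index x j * g i - vec_index x i * g j = 0"
    \<comment> \<open>The system lists each minor once, with \<open>i < j\<close>; comparing
      \<open>i\<close> with \<open>k\<close> yields the relation for either order, and
      \<open>i = k\<close> is trivial.\<close>
    have "vec_index x k * g i = vec_index x i * g k" if "i \<le> n" for i
      using 0[rule_format, of i k] 0[rule_format, of k i] that k(1)
      by (cases i k rule: linorder_cases) auto
    \<comment> \<open>The nonzero coordinate \<open>k\<close> determines the multiplier
      \<open>g k / vec_index x k\<close>, which has to equal 2\<alpha>.\<close>
    then show "\<exists>\<alpha>. \<forall>i\<le>n. g i = 2 * \<alpha> * vec_index x i"
      using k(2) by (intro exI[of _ "g k / (2 * vec_index x k)"]) (auto simp: field_simps)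
  qed
qed

section \<open>Unit vectors and the lines they span\<close>

lemma unit_sphere_carrier: "x \<in> unit_sphere n \<Longrightarrow> x \<in> carrier_vec (n + 1)"
  by (simp add: unit_sphere_def)

lemma unit_sphere_nonzero: "x \<in> unit_sphere n \<Longrightarrow> x \<in> nonzero_vecs n"
  by (auto simp: unit_sphere_def nonzero_vecs_def)

lemma proj_point_smult:
  assumes "c \<noteq> 0"
  shows "proj_point (c \<cdot>\<^sub>v v) = proj_point v"
proof -
  have "\<exists>b'. b \<cdot>\<^sub>v v = b' \<cdot>\<^sub>v (c \<cdot>\<^sub>v v)" for b
    \<comment> \<open>Since \<open>c\<close> is invertible, every multiple of \<open>v\<close> is
      also a multiple of \<open>c \<cdot>\<^sub>v v\<close>.\<close>
    using assms by (intro exI[of _ "b / c"]) (simp add: smult_smult_assoc)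
  then show ?thesis
    by (auto simp: proj_point_def smult_smult_assoc)
qed

lemma proj_point_eq_iff:
  assumes "u \<in> unit_sphere n" "v \<in> unit_sphere n"
  shows "proj_point u = proj_point v \<longleftrightarrow> v = u \<or> v = - u"
proof
  assume "proj_point u = proj_point v"
  moreover have "1 \<cdot>\<^sub>v v \<in> proj_point v"
    unfolding proj_point_def by blast
  ultimately have "v \<in> proj_point u" by simp
  then obtain c where c: "v = c \<cdot>\<^sub>v u"
    by (auto simp: proj_point_def)
  \<comment> \<open>Both vectors have squared norm 1, and scaling \<open>u\<close> by
    \<open>c\<close> multiplies the squared norm by \<open>c * c\<close>.\<close>
  have "c * c = 1"
    using assms unfolding c by (simp add: unit_sphere_def)
  then have "c = 1 \<or> c = - 1"
    by (metis square_eq_1_iff)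
  then show "v = u \<or> v = - u"
    by (auto simp: c)
next
  assume "v = u \<or> v = - u"
  moreover have "- u = (- 1) \<cdot>\<^sub>v u"
    by (intro eq_vecI) auto
  then have "proj_point (- u) = proj_point u"
    by (simp add: proj_point_smult)
  ultimately show "proj_point u = proj_point v" by auto
qed

text \<open>One nonzero coordinate makes the squared norm positive, so \<open>v\<close> can be
  divided by its norm. The factor is returned so that lines and homogeneous equations can be
  followed through the rescaling.\<close>

lemma normalize_unit_sphere:
  assumes "v \<in> nonzero_vecs n"
  obtains c where "c \<noteq> 0" "c \<cdot>\<^sub>v v \<in> unit_sphere n"
proof -
  have carr: "v \<in> carrier_vec (n + 1)"
    using assms by (simp add: nonzero_vecs_def)
  obtain k where k: "k \<le> n" "vec_index v k \<noteq> 0"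
    using assms by (rule nonzero_vecs_index)
  have "scalar_prod v v = (\<Sum>i<n + 1. (vec_index v i)\<^sup>2)"
    using carr by (simp add: scalar_prod_def power2_eq_square atLeast0LessThan)
  also have "\<dots> > 0"
    using k by (intro sum_pos2[of _ k]) auto
  finally have pos: "scalar_prod v v > 0" .
  define c where "c = 1 / sqrt (scalar_prod v v)"
  have "c * (c * scalar_prod v v) = 1"
    using pos by (simp add: c_def field_simps)
  then have "c \<cdot>\<^sub>v v \<in> unit_sphere n"
    using carr by (simp add: unit_sphere_def)
  moreover have "c \<noteq> 0" using pos by (simp add: c_def)
  ultimately show ?thesis using that by blast
qed

section \<open>The trilinear case\<close>

text \<open>On the spheres all three vectors are nonzero, so
  \<open>gradient_parallel_iff_minors\<close> applies to each argument with the other two held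
  fixed; off the spheres both sides are false.\<close>

lemma tri_extreme_iff:
  assumes "trilinear_form n m s l"
  shows "(x, y, z) \<in> tri_extreme n m s l \<longleftrightarrow>
     x \<in> unit_sphere n \<and> y \<in> unit_sphere m \<and> z \<in> unit_sphere s \<and>
     (\<forall>i j. i < j \<and> j \<le> n \<longrightarrow> l (minor_vec n x i j) y z = 0) \<and>
     (\<forall>i j. i < j \<and> j \<le> m \<longrightarrow> l x (minor_vec m y i j) z = 0) \<and>
     (\<forall>i j. i < j \<and> j \<le> s \<longrightarrow> l x y (minor_vec s z i j) = 0)"
proof (cases "x \<in> unit_sphere n \<and> y \<in> unit_sphere m \<and> z \<in> unit_sphere s")
  case True
  then have "linear_form_on (n + 1) (\<lambda>u. l u y z)" "linear_form_on (m + 1) (\<lambda>u. l x u z)"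
    "linear_form_on (s + 1) (\<lambda>u. l x y u)"
    using assms unit_sphere_carrier unfolding trilinear_form_def by blast+
  from this[THEN gradient_parallel_iff_minors] True unit_sphere_nonzero show ?thesis
    unfolding tri_extreme_def by simp
qed (auto simp: tri_extreme_def)

text \<open>This homogeneity carries the equations from arbitrary representatives of projective
  points to unit ones.\<close>

lemma trilinear_form_smult:
  assumes "trilinear_form n m s l"
    and "x \<in> carrier_vec (n + 1)" "y \<in> carrier_vec (m + 1)" "z \<in> carrier_vec (s + 1)"
  shows "l (a \<cdot>\<^sub>v x) (b \<cdot>\<^sub>v y) (c \<cdot>\<^sub>v z) = a * b * c * l x y z"
proof -
  have "l (a \<cdot>\<^sub>v x) (b \<cdot>\<^sub>v y) (c \<cdot>\<^sub>v z) = a * l x (b \<cdot>\<^sub>v y) (c \<cdot>\<^sub>v z)"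
    using assms by (simp add: trilinear_form_def linear_form_on_def)
  also have "l x (b \<cdot>\<^sub>v y) (c \<cdot>\<^sub>v z) = b * l x y (c \<cdot>\<^sub>v z)"
    using assms by (simp add: trilinear_form_def linear_form_on_def)
  also have "l x y (c \<cdot>\<^sub>v z) = c * l x y z"
    using assms by (simp add: trilinear_form_def linear_form_on_def)
  finally show ?thesis by simp
qed

lemma tri_bijection:
  assumes l: "trilinear_form n m s l"
  shows "\<exists>\<Phi>. bij_betw \<Phi> (tri_extreme_classes n m s l) (tri_solutions n m s l)"
proof -
  define f where "f = (\<lambda>(x, y, z). (proj_point x, proj_point y, proj_point z))"
  \<comment> \<open>Unit vectors span the same line exactly when they agree up to sign, so the sign
    relation is the kernel of \<open>f\<close> on extreme points.\<close>
  have rel: "tri_sign_rel n m s l =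
      {(a, b). a \<in> tri_extreme n m s l \<and> b \<in> tri_extreme n m s l \<and> f a = f b}"
    unfolding tri_sign_rel_def f_def using proj_point_eq_iff
    by (auto simp: tri_extreme_iff[OF l])
  have "f ` tri_extreme n m s l = tri_solutions n m s l"
  proof (intro equalityI subsetI)
    fix p assume "p \<in> f ` tri_extreme n m s l"
    then obtain x y z where ext: "(x, y, z) \<in> tri_extreme n m s l"
      and p: "p = (proj_point x, proj_point y, proj_point z)"
      by (auto simp: f_def)
    have "x \<in> nonzero_vecs n" "y \<in> nonzero_vecs m" "z \<in> nonzero_vecs s"
      using ext unit_sphere_nonzero by (auto simp: tri_extreme_def)
    then show "p \<in> tri_solutions n m s l"
      using ext unfolding p tri_extreme_iff[OF l] tri_solutions_def
      by (intro CollectI exI[of _ x] exI[of _ y] exI[of _ z]) simp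
  next
    fix p assume "p \<in> tri_solutions n m s l"
    then obtain x y z where p: "p = (proj_point x, proj_point y, proj_point z)"
      and nz: "x \<in> nonzero_vecs n" "y \<in> nonzero_vecs m" "z \<in> nonzero_vecs s"
      and eqs: "\<And>i j. i < j \<Longrightarrow> j \<le> n \<Longrightarrow> l (minor_vec n x i j) y z = 0"
        "\<And>i j. i < j \<Longrightarrow> j \<le> m \<Longrightarrow> l x (minor_vec m y i j) z = 0"
        "\<And>i j. i < j \<Longrightarrow> j \<le> s \<Longrightarrow> l x y (minor_vec s z i j) = 0"
      unfolding tri_solutions_def by (elim CollectE exE conjE) simp
    have carr: "x \<in> carrier_vec (n + 1)" "y \<in> carrier_vec (m + 1)" "z \<in> carrier_vec (s + 1)"
      using nz by (auto simp: nonzero_vecs_def)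
    obtain a b c where abc: "a \<noteq> 0" "a \<cdot>\<^sub>v x \<in> unit_sphere n" "b \<noteq> 0" "b \<cdot>\<^sub>v y \<in> unit_sphere m"
      "c \<noteq> 0" "c \<cdot>\<^sub>v z \<in> unit_sphere s"
      using nz by (metis normalize_unit_sphere)
    \<comment> \<open>A minor of a scaled vector is the scaled minor, so each equation at the unit
      vectors is \<open>a * b * c\<close> times the one at \<open>x\<close>, \<open>y\<close>,
      \<open>z\<close>.\<close>
    have "(a \<cdot>\<^sub>v x, b \<cdot>\<^sub>v y, c \<cdot>\<^sub>v z) \<in> tri_extreme n m s l"
      unfolding tri_extreme_iff[OF l]
      using abc eqs carr minor_vec_carrier
      by (auto simp: minor_vec_smult trilinear_form_smult[OF l])
    moreover have "f (a \<cdot>\<^sub>v x, b \<cdot>\<^sub>v y, c \<cdot>\<^sub>v z) = p"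
      using abc by (simp add: f_def p proj_point_smult)
    ultimately show "p \<in> f ` tri_extreme n m s l" by force
  qed
  with rel show ?thesis
    unfolding tri_extreme_classes_def by (rule bij_betw_quotient_kernel)
qed

section \<open>The multilinear case\<close>

lemma multilinear_form_slot:
  assumes "multilinear_form r n l" "x \<in> (\<Pi>\<^sub>E k\<in>{1..r}. carrier_vec (n k + 1))" "k \<in> {1..r}"
  shows "linear_form_on (n k + 1) (\<lambda>u. l (x(k := u)))"
  using assms unfolding multilinear_form_def by blast

lemma extreme_points_iff:
  assumes "multilinear_form r n l"
  shows "x \<in> extreme_points r n l \<longleftrightarrow> x \<in> (\<Pi>\<^sub>E k\<in>{1..r}. unit_sphere (n k)) \<and>
     (\<forall>k \<in> {1..r}. \<forall>i j. i < j \<and> j \<le> n k \<longrightarrow> l (x(k := minor_vec (n k) (x k) i j)) = 0)"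
proof (cases "x \<in> (\<Pi>\<^sub>E k\<in>{1..r}. unit_sphere (n k))")
  case True
  then have carr: "x \<in> (\<Pi>\<^sub>E k\<in>{1..r}. carrier_vec (n k + 1))"
    using unit_sphere_carrier by (auto simp: PiE_iff)
  have "(\<exists>\<alpha>. gradient (n k + 1) (\<lambda>u. l (x(k := u))) (x k) = (2 * \<alpha>) \<cdot>\<^sub>v x k) \<longleftrightarrow>
     (\<forall>i j. i < j \<and> j \<le> n k \<longrightarrow> l (x(k := minor_vec (n k) (x k) i j)) = 0)"
    if "k \<in> {1..r}" for k
    using True that unit_sphere_nonzero
    by (intro gradient_parallel_iff_minors multilinear_form_slot[OF assms carr]) (auto simp: PiE_iff)
  \<comment> \<open>Finding one function \<alpha> for all slots amounts to finding a multiplier in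
    each slot separately.\<close>
  moreover have "x \<in> extreme_points r n l \<longleftrightarrow>
     (\<forall>k\<in>{1..r}. \<exists>\<alpha>. gradient (n k + 1) (\<lambda>u. l (x(k := u))) (x k) = (2 * \<alpha>) \<cdot>\<^sub>v x k)"
    unfolding extreme_points_def bchoice_iff using True by auto
  ultimately show ?thesis using True by simp
qed (auto simp: extreme_points_def)

text \<open>The slots are scaled one at a time, by induction on the set \<open>A\<close> of slots
  already scaled in \<open>g A\<close>.\<close>

lemma multilinear_form_smult:
  assumes l: "multilinear_form r n l" and x: "x \<in> (\<Pi>\<^sub>E k\<in>{1..r}. carrier_vec (n k + 1))"
  shows "l (\<lambda>k\<in>{1..r}. c k \<cdot>\<^sub>v x k) = (\<Prod>k\<in>{1..r}. c k) * l x"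
proof -
  define g where "g A = (\<lambda>k\<in>{1..r}. if k \<in> A then c k \<cdot>\<^sub>v x k else x k)" for A
  have carr: "x k \<in> carrier_vec (n k + 1)" if "k \<in> {1..r}" for k
    using x that by blast
  have "l (g A) = prod c A * l x" if "A \<subseteq> {1..r}" for A
    using finite_subset[OF that finite_atLeastAtMost] that
  proof (induction A rule: finite_induct)
    case empty
    have "g {} = x" using x by (auto simp: g_def PiE_iff extensional_def fun_eq_iff)
    then show ?case by simp
  next
    case (insert k A)
    then have k: "k \<in> {1..r}" by simp
    have gA: "g A \<in> (\<Pi>\<^sub>E k\<in>{1..r}. carrier_vec (n k + 1))"
      using carr by (auto simp: g_def)
    have "g (insert k A) = (g A)(k := c k \<cdot>\<^sub>v x k)"
      using k by (auto simp: g_def fun_eq_iff)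
    then have "l (g (insert k A)) = c k * l ((g A)(k := x k))"
      using multilinear_form_slot[OF l gA k] carr[OF k] by (simp add: linear_form_on_def)
    \<comment> \<open>As \<open>k\<close> is not in \<open>A\<close>, slot \<open>k\<close> of
      \<open>g A\<close> still holds the unscaled \<open>x k\<close>.\<close>
    also have "(g A)(k := x k) = g A"
      using k insert.hyps by (auto simp: g_def fun_eq_iff)
    finally show ?case using insert by simp
  qed
  from this[of "{1..r}"] show ?thesis
    by (simp add: g_def cong: restrict_cong)
qed

lemma multi_bijection:
  assumes l: "multilinear_form r n l"
  shows "\<exists>\<Phi>. bij_betw \<Phi> (extreme_classes r n l) (solutions r n l)"
proof -
  define f :: "(nat \<Rightarrow> real vec) \<Rightarrow> nat \<Rightarrow> real vec set"
    where "f x = (\<lambda>k\<in>{1..r}. proj_point (x k))" for x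
  have "f x = f x' \<longleftrightarrow> (\<forall>k\<in>{1..r}. x' k = x k \<or> x' k = - x k)"
    if "x \<in> extreme_points r n l" "x' \<in> extreme_points r n l" for x x'
  proof -
    have "f x = f x' \<longleftrightarrow> (\<forall>k\<in>{1..r}. proj_point (x k) = proj_point (x' k))"
      by (auto simp: f_def fun_eq_iff restrict_def)
    also have "\<dots> \<longleftrightarrow> (\<forall>k\<in>{1..r}. x' k = x k \<or> x' k = - x k)"
      using that by (intro ball_cong refl proj_point_eq_iff) (auto simp: extreme_points_def)
    finally show ?thesis .
  qed
  then have rel: "sign_rel r n l =
      {(a, b). a \<in> extreme_points r n l \<and> b \<in> extreme_points r n l \<and> f a = f b}"
    unfolding sign_rel_def by blast
  have "f ` extreme_points r n l = solutions r n l"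
  proof (intro equalityI subsetI)
    fix p assume "p \<in> f ` extreme_points r n l"
    then obtain x where x: "x \<in> extreme_points r n l" and p: "p = f x" by blast
    have "x \<in> (\<Pi>\<^sub>E k\<in>{1..r}. nonzero_vecs (n k))"
      using x unit_sphere_nonzero by (auto simp: extreme_points_def PiE_iff)
    with x show "p \<in> solutions r n l"
      unfolding p f_def extreme_points_iff[OF l] solutions_def by blast
  next
    fix p assume "p \<in> solutions r n l"
    then obtain x where p: "p = f x"
      and nz: "x \<in> (\<Pi>\<^sub>E k\<in>{1..r}. nonzero_vecs (n k))"
      and eqs: "\<And>k i j. k \<in> {1..r} \<Longrightarrow> i < j \<Longrightarrow> j \<le> n k \<Longrightarrow>
        l (x(k := minor_vec (n k) (x k) i j)) = 0"
      unfolding solutions_def f_def by blast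
    have carr: "x \<in> (\<Pi>\<^sub>E k\<in>{1..r}. carrier_vec (n k + 1))"
      using nz by (auto simp: nonzero_vecs_def PiE_iff)
    have "\<forall>k\<in>{1..r}. \<exists>c. c \<noteq> 0 \<and> c \<cdot>\<^sub>v x k \<in> unit_sphere (n k)"
      using nz normalize_unit_sphere by (metis PiE_mem)
    then obtain c where c: "\<And>k. k \<in> {1..r} \<Longrightarrow> c k \<noteq> 0 \<and> c k \<cdot>\<^sub>v x k \<in> unit_sphere (n k)"
      by metis
    define y where "y = (\<lambda>k\<in>{1..r}. c k \<cdot>\<^sub>v x k)"
    have "l (y(k := minor_vec (n k) (y k) i j)) = 0"
      if k: "k \<in> {1..r}" and ij: "i < j" "j \<le> n k" for k i j
    proof -
      \<comment> \<open>The tuple \<open>?w\<close> occurs in the equation for \<open>x\<close>.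
        Scaling all its slots by \<open>c\<close>, including the minor in slot \<open>k\<close>,
        gives the tuple in the equation for \<open>y\<close>, so homogeneity transfers the
        zero.\<close>
      let ?w = "x(k := minor_vec (n k) (x k) i j)"
      have "?w \<in> (\<Pi>\<^sub>E k\<in>{1..r}. carrier_vec (n k + 1))"
        using carr k minor_vec_carrier by (auto simp: PiE_iff extensional_def)
      moreover have "minor_vec (n k) (c k \<cdot>\<^sub>v x k) i j = c k \<cdot>\<^sub>v minor_vec (n k) (x k) i j"
        using carr k ij by (intro minor_vec_smult) auto
      then have "y(k := minor_vec (n k) (y k) i j) = (\<lambda>k\<in>{1..r}. c k \<cdot>\<^sub>v ?w k)"
        using k by (auto simp: y_def fun_eq_iff)
      ultimately show ?thesis
        using multilinear_form_smult[OF l, of ?w c] eqs[OF k ij] by (simp only: mult_zero_right)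
    qed
    moreover have "y \<in> (\<Pi>\<^sub>E k\<in>{1..r}. unit_sphere (n k))"
      using c by (auto simp: y_def)
    ultimately have "y \<in> extreme_points r n l"
      using extreme_points_iff[OF l] by blast
    moreover have "f y = p"
      using c by (auto simp: f_def p y_def proj_point_smult fun_eq_iff)
    ultimately show "p \<in> f ` extreme_points r n l" by blast
  qed
  with rel show ?thesis
    unfolding extreme_classes_def by (rule bij_betw_quotient_kernel)
qed

theorem proposition16:
  shows "(\<forall>n m s :: nat.
            \<exists>U. zariski_open (tri_index n m s) U \<and> U \<noteq> {} \<and>
              (\<forall>l. trilinear_form n m s l \<and> tri_coeffs n m s l \<in> U \<longrightarrow>
                (\<exists>\<Phi>. bij_betw \<Phi> (tri_extreme_classes n m s l) (tri_solutions n m s l))))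
       \<and> (\<forall>(r :: nat) (ns :: nat \<Rightarrow> nat). 1 \<le> r \<longrightarrow>
            (\<exists>U. zariski_open (multi_index r ns) U \<and> U \<noteq> {} \<and>
              (\<forall>l. multilinear_form r ns l \<and> form_coeffs r ns l \<in> U \<longrightarrow>
                (\<exists>\<Phi>. bij_betw \<Phi> (extreme_classes r ns l) (solutions r ns l)))))"
proof (intro conjI allI impI)
  fix n m s :: nat
  show "\<exists>U. zariski_open (tri_index n m s) U \<and> U \<noteq> {} \<and>
      (\<forall>l. trilinear_form n m s l \<and> tri_coeffs n m s l \<in> U \<longrightarrow>
        (\<exists>\<Phi>. bij_betw \<Phi> (tri_extreme_classes n m s l) (tri_solutions n m s l)))"
    \<comment> \<open>The bijection is available for every trilinear form, so the whole coefficient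
      space serves as \<open>U\<close>; the same choice is made for multilinear forms below.\<close>
    using zariski_open_whole_space tri_bijection
    by (intro exI[of _ "tri_index n m s \<rightarrow>\<^sub>E UNIV"]) (auto simp: PiE_eq_empty_iff)
next
  fix r :: nat and ns :: "nat \<Rightarrow> nat"
  show "\<exists>U. zariski_open (multi_index r ns) U \<and> U \<noteq> {} \<and>
      (\<forall>l. multilinear_form r ns l \<and> form_coeffs r ns l \<in> U \<longrightarrow>
        (\<exists>\<Phi>. bij_betw \<Phi> (extreme_classes r ns l) (solutions r ns l)))"
    using zariski_open_whole_space multi_bijection
    by (intro exI[of _ "multi_index r ns \<rightarrow>\<^sub>E UNIV"]) (auto simp: PiE_eq_empty_iff)
qed

end
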